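(* Let $n\ge 2$ be an integer and let $f(r)=\sinh r$. Every solution $y:(0,\infty)\to\mathbb{R}$ of the equation $$y''+(n-1)\frac{f'}{f}\,y'-(n-1)\frac{y}{f^2}=0\qquad\text{for } r>0$$ satisfying the conditions $$\lim_{r\to 0^+}y(r)=+\infty,\qquad \lim_{r\to+\infty}y(r)=0,\qquad y'(r)<0 \ \text{ for all } r>0$$ is of the form $y(r)=c\,\sinh^{1-n}r$ for some positive constant $c$.
   Context: Here $\sinh^{1-n}r$ means $(\sinh r)^{1-n}$. *)

theory Defs
  imports "HOL-Analysis.Analysis"
begin

end

theory Submission
  imports Defs
begin

text \<open>
  Since \<open>coth' = - 1 / sinh\<^sup>2\<close>, the equation is exact: it says that \<open>y' + (n - 1) coth r y\<close>
  is a constant \<open>C\<close>.  As \<open>y\<close> tends to 0 at infinity, \<open>y'\<close> tends to \<open>C\<close>, which forces \<open>C = 0\<close>.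
  The remaining first-order equation says that \<open>sinh\<^sup>n\<^sup>-\<^sup>1 y\<close> is constant.
\<close>

text \<open>On a unit interval far out, the mean value theorem turns the increment of
  \<open>y\<close> into a value of \<open>y'\<close>. The increment is small because
  \<open>y\<close> converges, while the value is close to \<open>C\<close>.\<close>

lemma derivative_limit_zero_at_top:
  fixes y y' :: "real \<Rightarrow> real"
  assumes der: "\<And>r. r > a \<Longrightarrow> (y has_real_derivative y' r) (at r)"
    and y: "(y \<longlongrightarrow> l) at_top" and y': "(y' \<longlongrightarrow> C) at_top"
  shows "C = 0"
proof -
  have "\<bar>C\<bar> \<le> e" if e: "e > 0" for e
  proof -
    \<comment> \<open>Three errors add up to \<open>e\<close>: one from each endpoint value of
      \<open>y\<close>, and one from replacing \<open>y' z\<close> by \<open>C\<close>.\<close>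
    from e have "\<forall>\<^sub>F r in at_top. dist (y r) l < e / 3 \<and> dist (y' r) C < e / 3 \<and> r > a"
      using tendstoD[OF y, of "e / 3"] tendstoD[OF y', of "e / 3"] eventually_gt_at_top[of a]
      by (simp add: eventually_conj)
    then obtain R where R: "\<And>r. r \<ge> R \<Longrightarrow> dist (y r) l < e / 3 \<and> dist (y' r) C < e / 3 \<and> r > a"
      unfolding eventually_at_top_linorder by blast
    obtain z where z: "z > R" "y (R + 1) - y R = (R + 1 - R) * y' z"
      using MVT2[of R "R + 1" y y'] der R by force
    then show ?thesis
      using R[of R] R[of "R + 1"] R[of z] by (auto simp: dist_real_def abs_if split: if_splits)
  qed
  then show ?thesis
    using field_le_epsilon[of "\<bar>C\<bar>" 0] by simp
qed

lemma tendsto_coth_at_top: "((\<lambda>r::real. cosh r / sinh r) \<longlongrightarrow> 1) at_top"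
proof -
  have "((\<lambda>r::real. inverse (tanh r)) \<longlongrightarrow> inverse 1) at_top"
    by (intro tendsto_inverse tanh_real_at_top) simp
  then show ?thesis by (simp add: tanh_def)
qed

lemma has_real_derivative_coth:
  assumes "(r::real) \<noteq> 0"
  shows "((\<lambda>r. cosh r / sinh r) has_real_derivative - (1 / (sinh r)\<^sup>2)) (at r)"
proof -
  have "((\<lambda>r. cosh r / sinh r) has_real_derivative
      (sinh r * sinh r - cosh r * cosh r) / (sinh r * sinh r)) (at r)"
    using assms by (auto intro!: derivative_eq_intros)
  also have "(sinh r * sinh r - cosh r * cosh r) / (sinh r * sinh r) = - (1 / (sinh r)\<^sup>2)"
    using cosh_square_eq[of r] by (simp add: power2_eq_square)
  finally show ?thesis .
qed

lemma deriv_sinh: "deriv sinh r = cosh (r::real)"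
  by (rule DERIV_imp_deriv) (auto intro!: derivative_eq_intros)

theorem lemma1p1:
  fixes n :: int and f y y' y'' :: "real \<Rightarrow> real"
  assumes "n \<ge> 2"
    and "f = (\<lambda>r. sinh r)"
    and "\<And>r. r > 0 \<Longrightarrow> (y has_real_derivative y' r) (at r)"
    and "\<And>r. r > 0 \<Longrightarrow> (y' has_real_derivative y'' r) (at r)"
    and "\<And>r. r > 0 \<Longrightarrow>
      y'' r + (of_int n - 1) * (deriv f r / f r) * y' r - (of_int n - 1) * (y r / (f r)\<^sup>2) = 0"
    and "filterlim y at_top (at_right 0)"
    and "(y \<longlongrightarrow> 0) at_top"
    and "\<And>r. r > 0 \<Longrightarrow> y' r < 0"
  shows "\<exists>c>0. \<forall>r>0. y r = c * sinh r powi (1 - n)"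
proof -
  \<comment> \<open>A natural exponent lets \<open>sinh r ^ k\<close> be differentiated as an
    ordinary power; \<open>n \<ge> 2\<close> makes it positive.\<close>
  define k where "k = nat (n - 1)"
  have k: "k > 0" "of_int n - 1 = real k" "1 - n = - int k"
    using assms(1) by (auto simp: k_def)
  have sinh_pos: "sinh r > 0" if "r > 0" for r :: real
    using that by simp
  define g where "g = (\<lambda>r. y' r + k * (cosh r / sinh r * y r))"
  have "(g has_real_derivative 0) (at r)" if "r > 0" for r
  proof -
    have "(g has_real_derivative
        y'' r + k * (- (1 / (sinh r)\<^sup>2) * y r + y' r * (cosh r / sinh r))) (at r)"
      unfolding g_def using that
      by (intro DERIV_add DERIV_cmult DERIV_mult assms(3,4) has_real_derivative_coth) auto
    \<comment> \<open>This is the given equation itself, with \<open>deriv f\<close> evaluated to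
      \<open>cosh\<close>.\<close>
    moreover have "y'' r + k * (- (1 / (sinh r)\<^sup>2) * y r + y' r * (cosh r / sinh r)) = 0"
      using assms(5)[OF that] by (simp add: assms(2) deriv_sinh k(2) algebra_simps)
    ultimately show ?thesis by simp
  qed
  then have "\<exists>C. \<forall>r\<in>{0<..}. g r = C"
    by (intro has_field_derivative_zero_constant) (auto intro: has_field_derivative_at_within)
  then obtain C where C: "\<And>r. r > 0 \<Longrightarrow> g r = C"
    by auto
  \<comment> \<open>Constancy of \<open>g\<close>, solved for \<open>y'\<close>, gives this
    expression; its limit is \<open>C\<close> because \<open>coth\<close> tends to 1 and
    \<open>y\<close> to 0.\<close>
  have "((\<lambda>r. C - real k * (cosh r / sinh r * y r)) \<longlongrightarrow> C - real k * (1 * 0)) at_top"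
    by (intro tendsto_intros tendsto_coth_at_top assms(7))
  moreover have "\<forall>\<^sub>F r in at_top. C - real k * (cosh r / sinh r * y r) = y' r"
    using eventually_gt_at_top[of 0] by eventually_elim (simp add: g_def flip: C)
  ultimately have "(y' \<longlongrightarrow> C) at_top"
    by (simp add: tendsto_cong)
  with assms(3,7) have "C = 0"
    by (rule derivative_limit_zero_at_top)
  \<comment> \<open>With \<open>C = 0\<close> the equation reads \<open>y' + k coth r y = 0\<close>,
    for which \<open>sinh r ^ k\<close> is an integrating factor.\<close>
  have "((\<lambda>r. y r * sinh r ^ k) has_real_derivative 0) (at r)" if "r > 0" for r
  proof -
    have "((\<lambda>r. y r * sinh r ^ k) has_real_derivative
        y' r * sinh r ^ k + (k * (cosh r * sinh r ^ (k - 1))) * y r) (at r)"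
      using that by (auto intro!: derivative_eq_intros assms(3))
    also have "y' r * sinh r ^ k + (k * (cosh r * sinh r ^ (k - 1))) * y r = g r * sinh r ^ k"
      \<comment> \<open>Positivity of \<open>k\<close> permits splitting \<open>sinh r ^ k\<close>
        as \<open>sinh r * sinh r ^ (k - 1)\<close>.\<close>
      using k(1) sinh_pos[OF that] by (simp add: g_def power_eq_if field_simps)
    finally show ?thesis
      using C[OF that] \<open>C = 0\<close> by simp
  qed
  then have "\<exists>c. \<forall>r\<in>{0<..}. y r * sinh r ^ k = c"
    by (intro has_field_derivative_zero_constant) (auto intro: has_field_derivative_at_within)
  then obtain c where c: "\<And>r. r > 0 \<Longrightarrow> y r * sinh r ^ k = c"
    by auto
  \<comment> \<open>The blow-up at 0 supplies a point where \<open>y\<close> is positive, and this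
    fixes the sign of \<open>c\<close>.\<close>
  have "\<forall>\<^sub>F r in at_right 0. y r > 0 \<and> r > (0::real)"
    using assms(6) by (simp add: filterlim_at_top_dense eventually_conj eventually_at_right_less)
  then obtain r where "y r > 0" "r > 0"
    using eventually_happens[OF _, of _ "at_right (0::real)"] by force
  with c[of r] sinh_pos[of r] have "c > 0"
    by (metis mult_pos_pos zero_less_power)
  moreover have "y r = c * sinh r powi (1 - n)" if "r > 0" for r
    using c[OF that] sinh_pos[OF that] unfolding k(3)
    by (simp add: power_int_minus field_simps)
  ultimately show ?thesis by blast
qed

end
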